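(* Suppose $X$ is a Banach space, $U$ is a Hilbert space, and the pair $X\hookrightarrow U$ forms a Gelfand triple. Let the following hold: 1. $A^{r,2}(U):=A^{r,2}(U,\{A_j\}_{j\in\mathbb{N}_0})\subseteq X$ is an approximation space for $r>0$; 2. $u^*=R_Uu$ for some $u\in U$, with $R_U:U\to U^*$ the Riesz map; 3. $A_j\subset X$ for all $j\in\mathbb{N}_0$, and $\Pi_j$ is the $U$-orthogonal projection onto $A_j$. Then the sequence $\{\Pi_j'u^*\}_{j\in\mathbb{N}}$ converges to $u^*\in U^*\subset X^*$ in the $\mathrm{weak}^*(X^*,A^{r,2}(U))$ topology with the rate $$\left|\langle (I-\Pi_j')u^*,f\rangle_{X^*\times X}\right|\lesssim 2^{-rj}\,\|u\|_U\,\|f\|_{A^{r,2}(U)}\qquad\text{for all } f\in A^{r,2}(U).$$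
   Context: Gelfand triple: $X$ is a Banach space that is a dense subspace of the Hilbert space $U$ with continuous injection $X\hookrightarrow U$; via the Riesz map $R_U:U\to U^*$, $\langle R_Uu,v\rangle_{U^*\times U}=(u,v)_U$, one has $X\hookrightarrow U\approx U^*\hookrightarrow X^*$, and the duality pairing satisfies $\langle R_Ug,f\rangle_{X^*\times X}=(g,f)_U$ for $g\in U$, $f\in X$. The $A_j$ are nested finite dimensional linear subspaces $A_0\subseteq A_1\subseteq\dots$ of $U$ with dense union. With $\Pi_{-1}:=0$ and $Q_j:=\Pi_j-\Pi_{j-1}$, $$A^{r,2}(U):=\Big\{f\in U\;\Big|\;|f|^2_{A^{r,2}(U)}:=\sum_{j\ge0}2^{2rj}\|Q_jf\|_U^2<\infty\Big\},\qquad \|f\|_{A^{r,2}(U)}:=\|f\|_U+|f|_{A^{r,2}(U)}.$$ The dual operator $\Pi_j'$ satisfies, for $g^*=R_Ug$ with $g\in U$ and $f\in X$, $\langle\Pi_j'g^*,f\rangle_{X^*\times X}=(g,\Pi_jf)_U$. For a subset $S\subset X$, $\mathrm{weak}^*(X^*,S)$ is the topology on $X^*$ of pointwise convergence on the elements of $S$. $a\lesssim b$ means $a\le c\,b$ with a constant $c>0$ independent of $j,u,f$. *)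

theory Defs
  imports "HOL-Analysis.Analysis"
begin

text \<open>
  The Banach space \<open>X\<close> is a type of its own, and the inclusion of \<open>X\<close> into \<open>U\<close> is an explicit
  bounded linear map \<open>\<iota>\<close>; an element \<open>f \<in> X\<close>, regarded as an element of \<open>U\<close>, is \<open>\<iota> f\<close>.
  All scalars are real.
\<close>

definition gelfand_triple :: "('x::banach \<Rightarrow>\<^sub>L 'u::{real_inner,complete_space}) \<Rightarrow> bool" where
  "gelfand_triple \<iota> \<longleftrightarrow> inj (blinfun_apply \<iota>) \<and> closure (range (blinfun_apply \<iota>)) = UNIV"

abbreviation riesz :: "'u::{real_inner,complete_space} \<Rightarrow> 'u \<Rightarrow>\<^sub>L real" where
  "riesz \<equiv> blinfun_inner_right"

definition dual_op ::
  "('x::real_normed_vector \<Rightarrow>\<^sub>L 'y::real_normed_vector) \<Rightarrow> ('y \<Rightarrow>\<^sub>L real) \<Rightarrow> ('x \<Rightarrow>\<^sub>L real)" where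
  "dual_op T g = g o\<^sub>L T"

text \<open>The inclusion of \<open>U\<^sup>*\<close> into \<open>X\<^sup>*\<close> restricts functionals to \<open>X\<close>, that is, it is \<open>dual_op \<iota>\<close>.\<close>

definition riesz_in_dual ::
  "('x::banach \<Rightarrow>\<^sub>L 'u::{real_inner,complete_space}) \<Rightarrow> 'u \<Rightarrow> 'x \<Rightarrow>\<^sub>L real" where
  "riesz_in_dual \<iota> u = dual_op \<iota> (riesz u)"

lemma riesz_in_dual_apply: "blinfun_apply (riesz_in_dual \<iota> u) f = u \<bullet> blinfun_apply \<iota> f"
  by (simp add: riesz_in_dual_def dual_op_def)

definition approx_family :: "(nat \<Rightarrow> 'u::real_inner set) \<Rightarrow> bool" where
  "approx_family A \<longleftrightarrow>
     (\<forall>j. \<exists>B. finite B \<and> A j = span B) \<and> incseq A \<and> closure (\<Union>j. A j) = UNIV"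

definition orth_proj :: "'u::real_inner set \<Rightarrow> 'u \<Rightarrow> 'u" where
  "orth_proj S x = (THE y. y \<in> S \<and> (\<forall>v\<in>S. orthogonal (x - y) v))"

text \<open>The first case is the convention \<open>\<Pi>\<^sub>-\<^sub>1 = 0\<close>.\<close>

definition Qproj :: "(nat \<Rightarrow> 'u::real_inner set) \<Rightarrow> nat \<Rightarrow> 'u \<Rightarrow> 'u" where
  "Qproj A j x =
     (if j = 0 then orth_proj (A 0) x else orth_proj (A j) x - orth_proj (A (j - 1)) x)"

definition approx_space :: "real \<Rightarrow> (nat \<Rightarrow> 'u::real_inner set) \<Rightarrow> 'u set" where
  "approx_space r A = {f. summable (\<lambda>j. 2 powr (2 * r * real j) * (norm (Qproj A j f))\<^sup>2)}"

definition approx_seminorm :: "real \<Rightarrow> (nat \<Rightarrow> 'u::real_inner set) \<Rightarrow> 'u \<Rightarrow> real" where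
  "approx_seminorm r A f = sqrt (\<Sum>j. 2 powr (2 * r * real j) * (norm (Qproj A j f))\<^sup>2)"

definition approx_norm :: "real \<Rightarrow> (nat \<Rightarrow> 'u::real_inner set) \<Rightarrow> 'u \<Rightarrow> real" where
  "approx_norm r A f = norm f + approx_seminorm r A f"

text \<open>
  For \<open>S \<subseteq> X\<close>, the orthogonal projection of \<open>U\<close> onto \<open>S\<close> restricts to an operator on \<open>X\<close>.
  It is bounded when \<open>S\<close> is finite dimensional (\<open>proj_on_apply\<close> below), so that \<open>Blinfun\<close>
  is applied to a bounded linear map.
\<close>

definition proj_on ::
  "('x::banach \<Rightarrow>\<^sub>L 'u::{real_inner,complete_space}) \<Rightarrow> 'u set \<Rightarrow> 'x \<Rightarrow>\<^sub>L 'x" where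
  "proj_on \<iota> S = Blinfun (\<lambda>f. inv (blinfun_apply \<iota>) (orth_proj S (blinfun_apply \<iota> f)))"

definition proj_dual ::
  "('x::banach \<Rightarrow>\<^sub>L 'u::{real_inner,complete_space}) \<Rightarrow> 'u set
     \<Rightarrow> ('x \<Rightarrow>\<^sub>L real) \<Rightarrow> ('x \<Rightarrow>\<^sub>L real)" where
  "proj_dual \<iota> S = dual_op (proj_on \<iota> S)"

text \<open>
  The topology of pointwise convergence on \<open>S\<close>. Functionals are restricted to \<open>S\<close> because the
  points of \<open>product_topology\<close> are extensional functions.
\<close>

definition weak_star_on :: "'x::real_normed_vector set \<Rightarrow> ('x \<Rightarrow>\<^sub>L real) topology" where
  "weak_star_on S =
     pullback_topology UNIV (\<lambda>g. restrict (blinfun_apply g) S)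
       (product_topology (\<lambda>_. euclidean) S)"

lemma topspace_weak_star_on: "topspace (weak_star_on S) = UNIV"
  by (auto simp: weak_star_on_def topspace_pullback_topology)

lemma orth_proj_unique:
  assumes S: "subspace S" and y: "y \<in> S" "\<And>v. v \<in> S \<Longrightarrow> orthogonal (x - y) v"
  shows "orth_proj S x = y"
  unfolding orth_proj_def
proof (rule the_equality)
  show "y \<in> S \<and> (\<forall>v\<in>S. orthogonal (x - y) v)" using y by blast
next
  fix z assume z: "z \<in> S \<and> (\<forall>v\<in>S. orthogonal (x - z) v)"
  have m: "z - y \<in> S" using S y z by (simp add: subspace_diff)
  have "(x - y) \<bullet> (z - y) = 0" "(x - z) \<bullet> (z - y) = 0"
    using y z m by (auto simp: orthogonal_def)
  then have "(z - y) \<bullet> (z - y) = 0"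
    by (simp add: inner_diff_left)
  then show "z = y" by simp
qed

lemma orth_proj_finite_dim:
  fixes S :: "'u::real_inner set"
  assumes "finite B" "S = span B"
  obtains C where "finite C" "C \<subseteq> S" "\<And>x. orth_proj S x = (\<Sum>c\<in>C. (x \<bullet> c / (c \<bullet> c)) *\<^sub>R c)"
    "\<And>x. orth_proj S x \<in> S" "\<And>x v. v \<in> S \<Longrightarrow> orthogonal (x - orth_proj S x) v"
proof -
  obtain C where C: "finite C" "span C = S" "pairwise orthogonal C"
    using basis_orthogonal[OF assms(1)] assms(2) by metis
  define p where "p x = (\<Sum>c\<in>C. (x \<bullet> c / (c \<bullet> c)) *\<^sub>R c)" for x
  have pS: "p x \<in> S" for x
    unfolding p_def C(2)[symmetric] by (intro span_sum span_scale span_base)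
  have orth: "orthogonal (x - p x) v" if "v \<in> S" for x v
  proof -
    have "orthogonal (x - p x) d" if d: "d \<in> C" for d
    proof -
      have "p x \<bullet> d = (\<Sum>c\<in>C. (x \<bullet> c / (c \<bullet> c)) * (c \<bullet> d))"
        by (simp add: p_def inner_sum_left)
      also have "\<dots> = (\<Sum>c\<in>C. if c = d then x \<bullet> d else 0)"
        using C(3) d by (intro sum.cong) (auto simp: pairwise_def orthogonal_def)
      also have "\<dots> = x \<bullet> d" using C(1) d by simp
      finally show ?thesis by (simp add: orthogonal_def inner_diff_left)
    qed
    then show ?thesis
      using that C(2) orthogonal_to_span by blast
  qed
  have S: "subspace S" using assms(2) by simp
  have eq: "orth_proj S x = p x" for x
    by (rule orth_proj_unique[OF S pS orth])
  show thesis
    by (rule that[of C]) (use C pS orth eq span_superset[of C] p_def in auto)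
qed

lemma proj_on_apply:
  assumes inj: "inj (blinfun_apply \<iota>)" and S: "finite B" "S = span B"
    and sub: "S \<subseteq> range (blinfun_apply \<iota>)"
  shows "blinfun_apply \<iota> (blinfun_apply (proj_on \<iota> S) f) = orth_proj S (blinfun_apply \<iota> f)"
proof -
  obtain C where C: "finite C" "C \<subseteq> S"
    "\<And>x. orth_proj S x = (\<Sum>c\<in>C. (x \<bullet> c / (c \<bullet> c)) *\<^sub>R c)" "\<And>x. orth_proj S x \<in> S"
    using orth_proj_finite_dim[OF S] by metis
  define q where "q f = (\<Sum>c\<in>C. (blinfun_apply \<iota> f \<bullet> c / (c \<bullet> c)) *\<^sub>R inv (blinfun_apply \<iota>) c)" for f
  have "blinfun_apply \<iota> (q f) = orth_proj S (blinfun_apply \<iota> f)" for f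
    unfolding q_def C(3) blinfun.sum_right blinfun.scaleR_right
    using C(2) sub by (intro sum.cong refl) (auto simp: f_inv_into_f)
  then have q: "inv (blinfun_apply \<iota>) (orth_proj S (blinfun_apply \<iota> f)) = q f" for f
    using inj by (metis inv_f_f)
  have "bounded_linear q"
    unfolding q_def divide_inverse by (intro bounded_linear_intros)
  then have "blinfun_apply (proj_on \<iota> S) f = q f"
    by (simp add: proj_on_def q bounded_linear_Blinfun_apply)
  then show ?thesis
    using \<open>\<And>f. blinfun_apply \<iota> (q f) = orth_proj S (blinfun_apply \<iota> f)\<close> by simp
qed

lemma proj_dual_riesz_in_dual:
  assumes "inj (blinfun_apply \<iota>)" "finite B" "S = span B" "S \<subseteq> range (blinfun_apply \<iota>)"
  shows "blinfun_apply (proj_dual \<iota> S (riesz_in_dual \<iota> g)) f = g \<bullet> orth_proj S (blinfun_apply \<iota> f)"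
  by (simp add: proj_dual_def dual_op_def riesz_in_dual_def proj_on_apply[OF assms])

end

theory Submission
  imports Defs
begin

text \<open>
  The pairing of \<open>(I - \<Pi>\<^sub>j')u\<^sup>*\<close> with \<open>f\<close> is the inner product \<open>(u, f - \<Pi>\<^sub>j f)\<close> of \<open>U\<close>, so by
  Cauchy--Schwarz the rate is a statement about best approximation in \<open>U\<close> alone: the Jackson
  inequality \<open>\<parallel>f - \<Pi>\<^sub>j f\<parallel> \<le> 2\<^bsup>-rj\<^esup> |f|\<close>, with constant one
  (\<open>jackson_inequality\<close>).

  For the Jackson inequality, the increments \<open>Q\<^sub>i f\<close> are mutually orthogonal because the spaces
  are nested. Hence \<open>\<parallel>\<Pi>\<^sub>n f - \<Pi>\<^sub>j f\<parallel>\<^sup>2\<close> is the sum of \<open>\<parallel>Q\<^sub>i f\<parallel>\<^sup>2\<close> over \<open>j < i \<le> n\<close>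
  (\<open>norm_orth_proj_diff\<close>), and on this range the weight \<open>2\<^bsup>2ri\<^esup>\<close> is at least \<open>2\<^bsup>2rj\<^esup>\<close>. The
  density of the union makes \<open>f - \<Pi>\<^sub>n f\<close> arbitrarily small (\<open>orth_proj_approximates\<close>), which
  removes the truncation at \<open>n\<close>. Weak-* convergence is pointwise convergence on the
  approximation space, and follows from the rate since \<open>r > 0\<close>.
\<close>

lemma approx_family_orth_proj:
  assumes "approx_family A"
  shows "orth_proj (A j) x \<in> A j" and "v \<in> A j \<Longrightarrow> (x - orth_proj (A j) x) \<bullet> v = 0"
proof -
  obtain B where B: "finite B" "A j = span B"
    using assms unfolding approx_family_def by blast
  show "orth_proj (A j) x \<in> A j" and "v \<in> A j \<Longrightarrow> (x - orth_proj (A j) x) \<bullet> v = 0"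
    using orth_proj_finite_dim[OF B] by (metis orthogonal_def)+
qed

lemma approx_family_subspace: "approx_family A \<Longrightarrow> subspace (A j)"
  unfolding approx_family_def by (metis subspace_span)

lemma approx_family_mono: "approx_family A \<Longrightarrow> i \<le> j \<Longrightarrow> A i \<subseteq> A j"
  unfolding approx_family_def by (blast dest: incseqD)

lemma orth_proj_nearest_point:
  assumes A: "approx_family A" and v: "v \<in> A j"
  shows "norm (x - orth_proj (A j) x) \<le> norm (x - v)"
proof -
  let ?d = "x - orth_proj (A j) x"
  have "orth_proj (A j) x - v \<in> A j"
    using approx_family_subspace[OF A] approx_family_orth_proj(1)[OF A] v
    by (rule subspace_diff)
  then have "?d \<bullet> (orth_proj (A j) x - v) = 0"
    by (rule approx_family_orth_proj(2)[OF A])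
  then have "?d \<bullet> ?d = ?d \<bullet> (x - v)"
    by (simp add: inner_diff_right)
  also have "\<dots> \<le> norm ?d * norm (x - v)"
    by (rule norm_cauchy_schwarz)
  finally have "norm ?d * norm ?d \<le> norm ?d * norm (x - v)"
    by (simp flip: power2_norm_eq_inner power2_eq_square)
  then show ?thesis
    by (cases "?d = 0") auto
qed

lemma orth_proj_approximates:
  assumes A: "approx_family A" and "e > 0"
  obtains n where "n \<ge> j" "norm (x - orth_proj (A n) x) < e"
proof -
  have "x \<in> closure (\<Union>j. A j)"
    using A by (simp add: approx_family_def)
  then obtain m v where v: "v \<in> A m" "dist v x < e"
    using \<open>e > 0\<close> unfolding closure_approachable by blast
  have "v \<in> A (max j m)"
    using v(1) approx_family_mono[OF A, of m "max j m"] by auto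
  then have "norm (x - orth_proj (A (max j m)) x) \<le> norm (x - v)"
    by (rule orth_proj_nearest_point[OF A])
  with v(2) show thesis
    by (intro that[of "max j m"]) (auto simp: dist_norm norm_minus_commute)
qed

text \<open>
  Pythagoras, one increment at a time: \<open>Q\<^bsub>n+1\<^esub> f\<close> is the difference of the two errors
  \<open>f - \<Pi>\<^sub>n f\<close> and \<open>f - \<Pi>\<^bsub>n+1\<^esub> f\<close>, both orthogonal to \<open>A n\<close>, while \<open>\<Pi>\<^sub>n f - \<Pi>\<^sub>j f\<close> lies in \<open>A n\<close>.
\<close>

lemma norm_orth_proj_diff:
  assumes A: "approx_family A" and "j \<le> n"
  shows "(norm (orth_proj (A n) x - orth_proj (A j) x))\<^sup>2 = (\<Sum>i\<in>{j<..n}. (norm (Qproj A i x))\<^sup>2)"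
  using \<open>j \<le> n\<close>
proof (induction n rule: dec_induct)
  case base
  then show ?case by simp
next
  case (step n)
  let ?P = "\<lambda>i. orth_proj (A i) x"
  have Q: "Qproj A (Suc n) x = ?P (Suc n) - ?P n"
    by (simp add: Qproj_def)
  have "?P j \<in> A n"
    using approx_family_mono[OF A] step.hyps(1) approx_family_orth_proj(1)[OF A] by blast
  then have mem: "?P n - ?P j \<in> A n"
    by (intro subspace_diff approx_family_subspace approx_family_orth_proj A)
  then have mem': "?P n - ?P j \<in> A (Suc n)"
    using approx_family_mono[OF A, of n "Suc n"] by auto
  have "orthogonal (Qproj A (Suc n) x) (?P n - ?P j)"
    using approx_family_orth_proj(2)[OF A mem, of x] approx_family_orth_proj(2)[OF A mem', of x]
    unfolding orthogonal_def Q by (simp add: inner_diff_left)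
  then have "(norm (Qproj A (Suc n) x + (?P n - ?P j)))\<^sup>2
      = (norm (Qproj A (Suc n) x))\<^sup>2 + (norm (?P n - ?P j))\<^sup>2"
    by (rule norm_add_Pythagorean)
  moreover have "{j<..Suc n} = insert (Suc n) {j<..n}"
    using step.hyps(1) by auto
  ultimately show ?case
    using step.IH by (simp add: Q)
qed

text \<open>
  For \<open>r \<ge> 0\<close> the weights \<open>2\<^bsup>2ri\<^esup>\<close> increase with \<open>i\<close>. Thus, up to the factor \<open>2\<^bsup>2rj\<^esup>\<close>, the tail
  sum that measures the error is bounded by the tail of the series of the seminorm.
\<close>

theorem jackson_inequality:
  assumes A: "approx_family A" and r: "r \<ge> 0" and x: "x \<in> approx_space r A"
  shows "norm (x - orth_proj (A j) x) \<le> 2 powr (- r * real j) * approx_seminorm r A x"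
proof (rule field_le_epsilon)
  fix e :: real
  assume "e > 0"
  then obtain n where n: "n \<ge> j" "norm (x - orth_proj (A n) x) < e"
    using orth_proj_approximates[OF A] by blast
  let ?w = "\<lambda>i. 2 powr (2 * r * real i) * (norm (Qproj A i x))\<^sup>2"
  let ?d = "norm (orth_proj (A n) x - orth_proj (A j) x)"
  have "2 powr (2 * r * real j) * ?d\<^sup>2 = (\<Sum>i\<in>{j<..n}. 2 powr (2 * r * real j) * (norm (Qproj A i x))\<^sup>2)"
    by (simp add: norm_orth_proj_diff[OF A n(1)] sum_distrib_left)
  also have "\<dots> \<le> (\<Sum>i\<in>{j<..n}. ?w i)"
    using r by (intro sum_mono mult_right_mono powr_mono mult_left_mono) auto
  also have "\<dots> \<le> suminf ?w"
    using x by (intro sum_le_suminf) (auto simp: approx_space_def)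
  finally have "sqrt (2 powr (2 * r * real j) * ?d\<^sup>2) \<le> approx_seminorm r A x"
    unfolding approx_seminorm_def by (rule real_sqrt_le_mono)
  moreover have "2 powr (2 * r * real j) = (2 powr (r * real j))\<^sup>2"
    by (simp add: power2_eq_square mult.assoc flip: powr_add)
  ultimately have "2 powr (r * real j) * ?d \<le> approx_seminorm r A x"
    by (simp add: real_sqrt_mult)
  then have "?d \<le> 2 powr (- r * real j) * approx_seminorm r A x"
    by (simp add: powr_minus field_simps)
  moreover have "norm (x - orth_proj (A j) x) \<le> norm (x - orth_proj (A n) x) + ?d"
    using norm_triangle_ineq[of "x - orth_proj (A n) x" "orth_proj (A n) x - orth_proj (A j) x"]
    by simp
  ultimately show "norm (x - orth_proj (A j) x) \<le> 2 powr (- r * real j) * approx_seminorm r A x + e"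
    using n(2) by simp
qed

lemma limitin_weak_star_on:
  assumes "\<And>f. f \<in> S \<Longrightarrow> ((\<lambda>n. blinfun_apply (g n) f) \<longlongrightarrow> blinfun_apply h f) F"
  shows "limitin (weak_star_on S) g h F"
  unfolding limitin_def topspace_weak_star_on
proof (intro conjI allI impI UNIV_I)
  fix V
  assume V: "openin (weak_star_on S) V \<and> h \<in> V"
  let ?R = "\<lambda>g. restrict (blinfun_apply g) S"
  obtain W where W: "openin (product_topology (\<lambda>_. euclidean) S) W" "V = ?R -` W"
    using V by (auto simp: weak_star_on_def openin_pullback_topology)
  have "limitin (product_topology (\<lambda>_. euclidean) S) (\<lambda>n. ?R (g n)) (?R h) F"
    using assms by (auto simp: limitin_componentwise)
  then have "\<forall>\<^sub>F n in F. ?R (g n) \<in> W"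
    using W V by (auto simp: limitin_def)
  then show "\<forall>\<^sub>F n in F. g n \<in> V"
    using W(2) by simp
qed

theorem theorem7p1:
  fixes \<iota> :: "'x::banach \<Rightarrow>\<^sub>L 'u::{real_inner,complete_space}"
    and A :: "nat \<Rightarrow> 'u set"
    and r :: real
  assumes "gelfand_triple \<iota>"
    and "approx_family A"
    and "r > 0"
    and "approx_space r A \<subseteq> range (blinfun_apply \<iota>)"
    and "\<And>j. A j \<subseteq> range (blinfun_apply \<iota>)"
  shows "(\<forall>u. limitin (weak_star_on {f. blinfun_apply \<iota> f \<in> approx_space r A})
                (\<lambda>j. proj_dual \<iota> (A j) (riesz_in_dual \<iota> u)) (riesz_in_dual \<iota> u) sequentially)
       \<and> (\<exists>c>0. \<forall>u j f. blinfun_apply \<iota> f \<in> approx_space r A \<longrightarrow>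
            \<bar>blinfun_apply (riesz_in_dual \<iota> u - proj_dual \<iota> (A j) (riesz_in_dual \<iota> u)) f\<bar>
              \<le> c * 2 powr (- r * real j) * norm u * approx_norm r A (blinfun_apply \<iota> f))"
proof -
  have pairing: "blinfun_apply (riesz_in_dual \<iota> u - proj_dual \<iota> (A j) (riesz_in_dual \<iota> u)) f
      = u \<bullet> (blinfun_apply \<iota> f - orth_proj (A j) (blinfun_apply \<iota> f))" for u j f
  proof -
    have "inj (blinfun_apply \<iota>)"
      using assms(1) by (simp add: gelfand_triple_def)
    moreover obtain B where "finite B" "A j = span B"
      using assms(2) unfolding approx_family_def by blast
    ultimately show ?thesis
      using proj_dual_riesz_in_dual[OF _ _ _ assms(5)]
      by (simp add: blinfun.diff_left riesz_in_dual_apply inner_diff_right)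
  qed
  have rate: "\<bar>blinfun_apply (riesz_in_dual \<iota> u - proj_dual \<iota> (A j) (riesz_in_dual \<iota> u)) f\<bar>
      \<le> 2 powr (- r * real j) * norm u * approx_norm r A (blinfun_apply \<iota> f)"
    if f: "blinfun_apply \<iota> f \<in> approx_space r A" for u j f
  proof -
    let ?x = "blinfun_apply \<iota> f"
    have "\<bar>u \<bullet> (?x - orth_proj (A j) ?x)\<bar> \<le> norm u * norm (?x - orth_proj (A j) ?x)"
      by (rule Cauchy_Schwarz_ineq2)
    also have "\<dots> \<le> norm u * (2 powr (- r * real j) * approx_norm r A ?x)"
    proof (rule mult_left_mono)
      have "norm (?x - orth_proj (A j) ?x) \<le> 2 powr (- r * real j) * approx_seminorm r A ?x"
        using assms(2,3) f by (intro jackson_inequality) auto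
      also have "\<dots> \<le> 2 powr (- r * real j) * approx_norm r A ?x"
        by (intro mult_left_mono) (auto simp: approx_norm_def)
      finally show "norm (?x - orth_proj (A j) ?x) \<le> 2 powr (- r * real j) * approx_norm r A ?x" .
    qed simp
    finally show ?thesis
      unfolding pairing by (simp add: mult_ac)
  qed
  have "limitin (weak_star_on {f. blinfun_apply \<iota> f \<in> approx_space r A})
      (\<lambda>j. proj_dual \<iota> (A j) (riesz_in_dual \<iota> u)) (riesz_in_dual \<iota> u) sequentially" for u
  proof (rule limitin_weak_star_on)
    fix f
    assume "f \<in> {f. blinfun_apply \<iota> f \<in> approx_space r A}"
    then have f: "blinfun_apply \<iota> f \<in> approx_space r A"
      by simp
    let ?c = "norm u * approx_norm r A (blinfun_apply \<iota> f)"
    have "(\<lambda>j. (2 powr (- r)) ^ j) \<longlonglongrightarrow> 0"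
      using assms(3) powr_less_mono[of "- r" 0 2] by (intro LIMSEQ_power_zero) auto
    then have "(\<lambda>j. 2 powr (- r * real j)) \<longlonglongrightarrow> 0"
      by (simp add: powr_power mult.commute)
    then have "(\<lambda>j. 2 powr (- r * real j) * ?c) \<longlonglongrightarrow> 0"
      by (rule tendsto_mult_left_zero)
    then have "(\<lambda>j. blinfun_apply (riesz_in_dual \<iota> u - proj_dual \<iota> (A j) (riesz_in_dual \<iota> u)) f)
        \<longlonglongrightarrow> 0"
      by (rule Lim_null_comparison[rotated]) (use rate[OF f] in \<open>simp add: mult_ac\<close>)
    then have "(\<lambda>j. blinfun_apply (riesz_in_dual \<iota> u) f
        - blinfun_apply (riesz_in_dual \<iota> u - proj_dual \<iota> (A j) (riesz_in_dual \<iota> u)) f)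
        \<longlonglongrightarrow> blinfun_apply (riesz_in_dual \<iota> u) f - 0"
      by (intro tendsto_intros)
    then show "(\<lambda>j. blinfun_apply (proj_dual \<iota> (A j) (riesz_in_dual \<iota> u)) f)
        \<longlonglongrightarrow> blinfun_apply (riesz_in_dual \<iota> u) f"
      by (simp add: blinfun.diff_left)
  qed
  moreover have "\<exists>c>0. \<forall>u j f. blinfun_apply \<iota> f \<in> approx_space r A \<longrightarrow>
      \<bar>blinfun_apply (riesz_in_dual \<iota> u - proj_dual \<iota> (A j) (riesz_in_dual \<iota> u)) f\<bar>
        \<le> c * 2 powr (- r * real j) * norm u * approx_norm r A (blinfun_apply \<iota> f)"
    using rate by (intro exI[of _ 1]) auto
  ultimately show ?thesis
    by blast
qed

end
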